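(* Let $X$ be a finite set with cardinality $n\ge 1$. Then every non-invertible map $\alpha\colon X\to X$ is a composition of at most $2(n-|\mathrm{fix}(\alpha)|)-1$ quasi-identities of $X$.
   Context: For a map $h\colon X\to X$, $\mathrm{fix}(h):=\{x\in X : h(x)=x\}$. A map $\tau\colon X\to X$ is called a quasi-identity if $|\mathrm{fix}(\tau)|=n-1$, where $n=|X|$. The composition is meant to be a non-empty finite functional composition. *)

theory Defs
  imports Main "HOL-Library.FuncSet"
begin

text \<open>A map from \<open>X\<close> to \<open>X\<close> is an element of \<open>X \<rightarrow>\<^sub>E X\<close>: it is \<open>undefined\<close> outside \<open>X\<close>, so
  that HOL equality of such functions is equality of maps on \<open>X\<close>. Accordingly, composition is
  \<^const>\<open>compose\<close> \<open>X\<close> and the identity map is \<open>\<lambda>x\<in>X. x\<close>.\<close>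

definition fixpoints :: "'a set \<Rightarrow> ('a \<Rightarrow> 'a) \<Rightarrow> 'a set" where
  "fixpoints X h = {x \<in> X. h x = x}"

definition invertible_map :: "'a set \<Rightarrow> ('a \<Rightarrow> 'a) \<Rightarrow> bool" where
  "invertible_map X h \<longleftrightarrow> h \<in> X \<rightarrow>\<^sub>E X \<and>
     (\<exists>g \<in> X \<rightarrow>\<^sub>E X. compose X g h = (\<lambda>x\<in>X. x) \<and> compose X h g = (\<lambda>x\<in>X. x))"

text \<open>The condition \<open>|fix(\<tau>)| = n - 1\<close> is written without truncated subtraction.\<close>

definition quasi_identity :: "'a set \<Rightarrow> ('a \<Rightarrow> 'a) \<Rightarrow> bool" where
  "quasi_identity X \<tau> \<longleftrightarrow> \<tau> \<in> X \<rightarrow>\<^sub>E X \<and> card (fixpoints X \<tau>) + 1 = card X"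

text \<open>\<open>composition X [\<tau>\<^sub>1, \<dots>, \<tau>\<^sub>k]\<close> is \<open>\<tau>\<^sub>1 \<circ> \<dots> \<circ> \<tau>\<^sub>k\<close>. It is the identity map for the empty list, so
  non-emptiness has to be required separately.\<close>

definition composition :: "'a set \<Rightarrow> ('a \<Rightarrow> 'a) list \<Rightarrow> 'a \<Rightarrow> 'a" where
  "composition X \<tau>s = foldr (compose X) \<tau>s (\<lambda>x\<in>X. x)"

end

theory Submission
  imports Defs
begin

text \<open>Write \<open>[p \<rightarrow> q]\<close> for the quasi-identity that sends \<open>p\<close> to \<open>q \<noteq> p\<close> and fixes every other
  point. If \<open>\<alpha> p = \<alpha> q\<close>, then \<open>\<alpha> = \<alpha>(p := z) \<circ> [p \<rightarrow> q]\<close> for every \<open>z\<close>: the value at \<open>p\<close> is never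
  read again, so it can be chosen freely (\<open>reassign_collapsed_point\<close>). The proof is an induction on
  the number \<open>d\<close> of points moved by \<open>\<alpha>\<close>. A map on a finite set that is not invertible is not
  injective, so there are \<open>p \<noteq> q\<close> with \<open>\<alpha> p = \<alpha> q\<close>, and one of them, say \<open>p\<close>, is moved.
  Taking \<open>z = p\<close> peels off one quasi-identity and leaves the map \<open>\<alpha>(p := p)\<close>, which moves \<open>d - 1\<close>
  points; the induction continues as long as that map is still not injective.

  If it is injective, then \<open>\<alpha>\<close> is a permutation of \<open>X - {p}\<close>, extended to \<open>p\<close> by \<open>\<alpha> p = \<alpha> q\<close>.
  If \<open>q\<close> is moved, it has a preimage under \<open>\<alpha>\<close> other than \<open>p\<close> and \<open>q\<close>, so that
  \<open>\<alpha>(q := q)\<close> is not injective, and exchanging \<open>p\<close> and \<open>q\<close> helps. If \<open>q\<close> is fixed and \<open>d \<ge> 2\<close>,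
  there is another moved point \<open>e\<close>, and \<open>p\<close> serves as scratch space for opening the cycle
  through \<open>e\<close>: choosing the free value at \<open>p\<close> to be \<open>\<alpha> e\<close> makes \<open>p\<close> and \<open>e\<close> collapse, so that \<open>e\<close>
  can be made a fixed point by a second quasi-identity. The preimage of \<open>e\<close> keeps the
  resulting map from being injective, and it moves \<open>d - 1\<close> points. Each step that removes a moved point
  spends at most two quasi-identities, and the last moved point costs one,
  since a map that moves one point is itself a quasi-identity. This gives \<open>2 * d - 1\<close>.\<close>

definition moved :: "'a set \<Rightarrow> ('a \<Rightarrow> 'a) \<Rightarrow> 'a set" where
  "moved X h = {x \<in> X. h x \<noteq> x}"

definition move_point :: "'a set \<Rightarrow> 'a \<Rightarrow> 'a \<Rightarrow> 'a \<Rightarrow> 'a" where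
  "move_point X p q = (\<lambda>x\<in>X. if x = p then q else x)"

definition quasi_product :: "'a set \<Rightarrow> nat \<Rightarrow> ('a \<Rightarrow> 'a) \<Rightarrow> bool" where
  "quasi_product X k \<alpha> \<longleftrightarrow> (\<exists>\<tau>s. \<tau>s \<noteq> [] \<and> length \<tau>s \<le> k \<and>
     (\<forall>\<tau> \<in> set \<tau>s. quasi_identity X \<tau>) \<and> \<alpha> = composition X \<tau>s)"

lemma finite_moved: "finite X \<Longrightarrow> finite (moved X h)"
  by (simp add: moved_def)

lemma card_moved_fixpoints:
  assumes "finite X"
  shows "card (moved X h) + card (fixpoints X h) = card X"
proof -
  have "X = moved X h \<union> fixpoints X h" "moved X h \<inter> fixpoints X h = {}"
    by (auto simp: moved_def fixpoints_def)
  moreover have "finite (moved X h)" "finite (fixpoints X h)"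
    using assms by (auto simp: moved_def fixpoints_def)
  ultimately show ?thesis by (metis card_Un_disjoint)
qed

lemma quasi_identity_iff_moved:
  assumes "finite X"
  shows "quasi_identity X \<tau> \<longleftrightarrow> \<tau> \<in> X \<rightarrow>\<^sub>E X \<and> card (moved X \<tau>) = 1"
  using card_moved_fixpoints[OF assms, of \<tau>] by (auto simp: quasi_identity_def)

lemma quasi_identity_move_point:
  assumes "finite X" "p \<in> X" "q \<in> X" "p \<noteq> q"
  shows "quasi_identity X (move_point X p q)"
proof -
  have "moved X (move_point X p q) = {p}"
    using assms by (auto simp: moved_def move_point_def)
  moreover have "move_point X p q \<in> X \<rightarrow>\<^sub>E X"
    using assms by (auto simp: move_point_def)
  ultimately show ?thesis
    using assms by (simp add: quasi_identity_iff_moved)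
qed

lemma reassign_collapsed_point:
  assumes "\<alpha> \<in> X \<rightarrow>\<^sub>E X" "p \<in> X" "q \<in> X" "p \<noteq> q" "\<alpha> p = \<alpha> q"
  shows "\<alpha> = compose X (\<alpha>(p := z)) (move_point X p q)"
proof
  fix x
  show "\<alpha> x = compose X (\<alpha>(p := z)) (move_point X p q) x"
    using assms by (cases "x \<in> X") (auto simp: compose_def move_point_def)
qed

lemma composition_snoc:
  assumes "\<sigma> \<in> X \<rightarrow>\<^sub>E X"
  shows "composition X (\<tau>s @ [\<sigma>]) = compose X (composition X \<tau>s) \<sigma>"
proof (induction \<tau>s)
  case Nil
  have "\<sigma> x = undefined" if "x \<notin> X" for x
    using assms that by (auto simp: PiE_def extensional_def)
  then show ?case
    using assms by (auto simp: composition_def compose_def fun_eq_iff)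
next
  case (Cons \<tau> \<tau>s)
  have "compose X \<tau> (compose X (composition X \<tau>s) \<sigma>)
      = compose X (compose X \<tau> (composition X \<tau>s)) \<sigma>"
    using assms by (auto simp: compose_def fun_eq_iff)
  with Cons show ?case by (simp add: composition_def)
qed

lemma quasi_product_compose:
  assumes "quasi_product X k \<beta>" "quasi_identity X \<sigma>"
  shows "quasi_product X (Suc k) (compose X \<beta> \<sigma>)"
proof -
  obtain \<tau>s where \<tau>s: "length \<tau>s \<le> k" "\<forall>\<tau> \<in> set \<tau>s. quasi_identity X \<tau>"
    "\<beta> = composition X \<tau>s"
    using assms(1) by (auto simp: quasi_product_def)
  have "\<sigma> \<in> X \<rightarrow>\<^sub>E X" using assms(2) by (simp add: quasi_identity_def)
  then show ?thesis
    unfolding quasi_product_def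
    using \<tau>s assms(2) by (intro exI[of _ "\<tau>s @ [\<sigma>]"]) (auto simp: composition_snoc)
qed

lemma quasi_product_mono: "quasi_product X k \<alpha> \<Longrightarrow> k \<le> l \<Longrightarrow> quasi_product X l \<alpha>"
  by (force simp: quasi_product_def)

lemma quasi_product_single: "quasi_identity X \<alpha> \<Longrightarrow> quasi_product X 1 \<alpha>"
  unfolding quasi_product_def
  by (intro exI[of _ "[\<alpha>]"])
     (auto simp: composition_def quasi_identity_def compose_def fun_eq_iff PiE_def extensional_def)

lemma quasi_product_reassign:
  assumes "finite X" "\<alpha> \<in> X \<rightarrow>\<^sub>E X" "p \<in> X" "q \<in> X" "p \<noteq> q" "\<alpha> p = \<alpha> q"
    and "quasi_product X k (\<alpha>(p := z))"
  shows "quasi_product X (Suc k) \<alpha>"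
  using quasi_product_compose[OF assms(7) quasi_identity_move_point[OF assms(1,3,4,5)]]
    reassign_collapsed_point[OF assms(2-6), of z] by simp

lemma not_inj_if_not_invertible:
  assumes "finite X" "\<alpha> \<in> X \<rightarrow>\<^sub>E X" "\<not> invertible_map X \<alpha>"
  shows "\<not> inj_on \<alpha> X"
proof
  assume inj: "inj_on \<alpha> X"
  have "\<alpha> ` X = X"
    using assms(1,2) inj by (intro endo_inj_surj) auto
  with inj have bij: "bij_betw \<alpha> X X" by (simp add: bij_betw_def)
  define g where "g = (\<lambda>x\<in>X. inv_into X \<alpha> x)"
  have "g \<in> X \<rightarrow>\<^sub>E X"
    using \<open>\<alpha> ` X = X\<close> by (auto simp: g_def inv_into_into)
  moreover have "compose X g \<alpha> = (\<lambda>x\<in>X. x)"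
    unfolding g_def using bij by (rule compose_inv_into_id)
  moreover have "compose X \<alpha> g = (\<lambda>x\<in>X. x)"
    unfolding g_def using \<open>\<alpha> ` X = X\<close> by (rule compose_id_inv_into)
  ultimately show False
    using assms(2,3) by (auto simp: invertible_map_def)
qed

text \<open>The descent: the map that remains after one or two quasi-identities is again not injective
  and moves one point fewer.\<close>

lemma quasi_product_if_not_inj:
  assumes "finite X" "\<alpha> \<in> X \<rightarrow>\<^sub>E X" "\<not> inj_on \<alpha> X"
  shows "quasi_product X (2 * card (moved X \<alpha>) - 1) \<alpha>"
  using assms(2,3)
proof (induction "card (moved X \<alpha>)" arbitrary: \<alpha> rule: less_induct)
  case less
  have maps: "\<alpha> x \<in> X" if "x \<in> X" for x
    using less.prems(1) that by auto
  \<comment> \<open>Of two distinct points with the same image, at most one is fixed.\<close>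
  obtain p q where pq: "p \<in> X" "q \<in> X" "p \<noteq> q" "\<alpha> p = \<alpha> q" "\<alpha> p \<noteq> p"
    using less.prems(2) unfolding inj_on_def by metis
  have p: "p \<in> moved X \<alpha>" using pq by (simp add: moved_def)
  have descend: "quasi_product X (2 * (card (moved X \<alpha>) - 1) - 1) \<beta>"
    if "\<beta> \<in> X \<rightarrow>\<^sub>E X" "\<not> inj_on \<beta> X" "moved X \<beta> = moved X \<alpha> - {e}" "e \<in> moved X \<alpha>" for \<beta> e
  proof -
    have "card (moved X \<beta>) = card (moved X \<alpha>) - 1" "card (moved X \<beta>) < card (moved X \<alpha>)"
      unfolding that(3)
      using that(4) finite_moved[OF assms(1), of \<alpha>] by (simp, intro card_Diff1_less)
    with less.hyps[OF _ that(1,2)] show ?thesis by simp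
  qed
  have fix_collapsed: ?case
    if "u \<in> X" "v \<in> X" "u \<noteq> v" "\<alpha> u = \<alpha> v" "\<alpha> u \<noteq> u" "\<not> inj_on (\<alpha>(u := u)) X" for u v
  proof -
    have "moved X (\<alpha>(u := u)) = moved X \<alpha> - {u}" "u \<in> moved X \<alpha>"
      using that by (auto simp: moved_def)
    moreover have "\<alpha>(u := u) \<in> X \<rightarrow>\<^sub>E X"
      using less.prems(1) that(1) by (auto simp: PiE_def extensional_def)
    ultimately have "quasi_product X (Suc (2 * (card (moved X \<alpha>) - 1) - 1)) \<alpha>"
      using that by (intro quasi_product_reassign[OF assms(1) less.prems(1) that(1-4)] descend)
    moreover have "0 < card (moved X \<alpha>)"
      using \<open>u \<in> moved X \<alpha>\<close> finite_moved[OF assms(1), of \<alpha>] by (auto simp: card_gt_0_iff)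
    ultimately show ?thesis
      by (elim quasi_product_mono) linarith
  qed
  show ?case
  proof (cases "inj_on (\<alpha>(p := p)) X")
    case False
    with fix_collapsed pq show ?thesis by blast
  next
    case inj: True
    have "\<alpha>(p := p) ` X = X"
      using assms(1) inj maps by (intro endo_inj_surj) auto
    then have preimage: "\<exists>y \<in> X. y \<noteq> p \<and> \<alpha> y = x" if "x \<in> X" "x \<noteq> p" for x
      using that by (smt (verit) fun_upd_apply imageE)
    show ?thesis
    proof (cases "\<alpha> q = q")
      case False
      obtain y where "y \<in> X" "y \<noteq> p" "\<alpha> y = q"
        using preimage pq by blast
      with False have "(\<alpha>(q := q)) y = (\<alpha>(q := q)) q" "y \<noteq> q" by auto
      with \<open>y \<in> X\<close> pq(2) have "\<not> inj_on (\<alpha>(q := q)) X" by (meson inj_onD)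
      with fix_collapsed[of q p] pq False show ?thesis by metis
    next
      case True
      show ?thesis
      proof (cases "moved X \<alpha> = {p}")
        case True
        then show ?thesis
          using quasi_product_single[of X \<alpha>] less.prems(1) assms(1)
          by (simp add: quasi_identity_iff_moved)
      next
        case False
        with p obtain e where e: "e \<in> X" "\<alpha> e \<noteq> e" "e \<noteq> p"
          by (auto simp: moved_def)
        \<comment> \<open>Hence \<open>p\<close> stays moved when it takes over the value of \<open>e\<close>.\<close>
        have "\<alpha> e \<noteq> p"
          using inj_onD[OF inj, of e p] e pq(1) by auto
        \<comment> \<open>The cycle through \<open>e\<close> is redirected through \<open>p\<close>, so \<open>p\<close> is moved in place of \<open>e\<close>.
          The fixed point \<open>q\<close> retains the old value of \<open>p\<close>.\<close>
        define \<alpha>1 where "\<alpha>1 = \<alpha>(p := \<alpha> e)"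
        define \<alpha>2 where "\<alpha>2 = \<alpha>1(e := e)"
        have \<alpha>1: "\<alpha>1 \<in> X \<rightarrow>\<^sub>E X"
          using less.prems(1) pq(1) maps[OF e(1)] by (auto simp: \<alpha>1_def PiE_def extensional_def)
        have \<alpha>2: "\<alpha>2 \<in> X \<rightarrow>\<^sub>E X"
          using \<alpha>1 e(1) by (auto simp: \<alpha>2_def PiE_def extensional_def)
        have moved: "moved X \<alpha>2 = moved X \<alpha> - {e}"
          using \<open>\<alpha> e \<noteq> p\<close> pq e by (auto simp: \<alpha>1_def \<alpha>2_def moved_def)
        have e': "e \<in> moved X \<alpha>" using e by (simp add: moved_def)
        obtain y where y: "y \<in> X" "y \<noteq> p" "\<alpha> y = e"
          using preimage e by blast
        with e have "\<alpha>2 y = \<alpha>2 e" "y \<noteq> e" by (auto simp: \<alpha>1_def \<alpha>2_def)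
        with y(1) e(1) have "\<not> inj_on \<alpha>2 X" by (meson inj_onD)
        with \<alpha>2 moved e' have "quasi_product X (2 * (card (moved X \<alpha>) - 1) - 1) \<alpha>2"
          by (intro descend)
        then have "quasi_product X (Suc (2 * (card (moved X \<alpha>) - 1) - 1)) \<alpha>1"
          unfolding \<alpha>2_def using e pq(1)
          by (intro quasi_product_reassign[OF assms(1) \<alpha>1 e(1) pq(1) e(3)]) (auto simp: \<alpha>1_def)
        then have "quasi_product X (Suc (Suc (2 * (card (moved X \<alpha>) - 1) - 1))) \<alpha>"
          unfolding \<alpha>1_def by (rule quasi_product_reassign[OF assms(1) less.prems(1) pq(1-4)])
        moreover have "card {p, e} \<le> card (moved X \<alpha>)"
          using p e' finite_moved[OF assms(1)] by (intro card_mono) auto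
        ultimately show ?thesis
          using e(3) by (elim quasi_product_mono) auto
      qed
    qed
  qed
qed

theorem theorem4p7:
  fixes X :: "'a set" and n :: nat and \<alpha> :: "'a \<Rightarrow> 'a"
  assumes "finite X" and "card X = n" and "n \<ge> 1"
    and "\<alpha> \<in> X \<rightarrow>\<^sub>E X" and "\<not> invertible_map X \<alpha>"
  shows "\<exists>\<tau>s. \<tau>s \<noteq> [] \<and>
    int (length \<tau>s) \<le> 2 * (int n - int (card (fixpoints X \<alpha>))) - 1 \<and>
    (\<forall>\<tau> \<in> set \<tau>s. quasi_identity X \<tau>) \<and>
    \<alpha> = composition X \<tau>s"
proof -
  obtain \<tau>s where \<tau>s: "\<tau>s \<noteq> []" "length \<tau>s \<le> 2 * card (moved X \<alpha>) - 1"
    "\<forall>\<tau> \<in> set \<tau>s. quasi_identity X \<tau>" "\<alpha> = composition X \<tau>s"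
    using quasi_product_if_not_inj[OF assms(1,4) not_inj_if_not_invertible[OF assms(1,4,5)]]
    by (auto simp: quasi_product_def)
  have "0 < length \<tau>s" using \<tau>s(1) by simp
  with \<tau>s(2) have "length \<tau>s + 1 \<le> 2 * card (moved X \<alpha>)" by linarith
  then have "int (length \<tau>s) + 1 \<le> 2 * int (card (moved X \<alpha>))" by presburger
  moreover have "int n = int (card (moved X \<alpha>)) + int (card (fixpoints X \<alpha>))"
    using card_moved_fixpoints[OF assms(1), of \<alpha>] assms(2) by simp
  ultimately have "int (length \<tau>s) \<le> 2 * (int n - int (card (fixpoints X \<alpha>))) - 1"
    by (simp add: algebra_simps)
  with \<tau>s show ?thesis by blast
qed

end
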